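(* Let $D$ be the graph of the dodecahedron and $I$ the graph of the icosahedron. Then $\mathscr{C}_5(D)\cong I$. Moreover, $\mathscr{C}_5(I)\cong I$. Hence the dodecahedron graph $D$ is (eventually) pentagon-periodic, i.e. there exist integers $m\ge 0$ and $p>0$ such that $\mathscr{C}_5^{n+p}(D)\cong \mathscr{C}_5^n(D)$ for all $n\ge m$.
   Context: All graphs are finite and simple. For a graph $G$, the pentagon graph $\mathscr{C}_5(G)$ is the graph whose vertices are the induced cycles of length $5$ in $G$ (regarded as subgraphs), where two distinct vertices are adjacent if and only if the corresponding induced $5$-cycles share at least one common edge. If $G$ has no induced $5$-cycles, then $\mathscr{C}_5(G)=\emptyset$ (the graph with no vertices). Iterates are defined by $\mathscr{C}_5^0(G)=G$ and $\mathscr{C}_5^{k+1}(G)=\mathscr{C}_5(\mathscr{C}_5^k(G))$. The graph of a polyhedron is its $1$-skeleton: $D$ is the $3$-regular graph of the regular dodecahedron ($20$ vertices, $30$ edges) and $I$ is the $5$-regular graph of the regular icosahedron ($12$ vertices, $30$ edges). *)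

theory Defs
  imports "HOL-Analysis.Analysis" "HOL-Library.FSet"
begin

section \<open>Finite graphs\<close>

text \<open>
  Using \<open>fset\<close> keeps graphs finite and makes \<open>'a graph\<close> a datatype with a relabelling
  function \<open>map_graph\<close>, through which other datatypes may recurse (see \<open>vertex\<close> below).
\<close>

datatype 'a graph = Graph (verts: "'a fset") (edges: "'a fset fset")

definition simple_graph :: "'a graph \<Rightarrow> bool" where
  "simple_graph G \<longleftrightarrow> (\<forall>e. e |\<in>| edges G \<longrightarrow> e |\<subseteq>| verts G \<and> fcard e = 2)"

definition graph_iso :: "'a graph \<Rightarrow> 'b graph \<Rightarrow> bool"  (infix \<open>\<cong>\<^sub>G\<close> 50) where
  "G \<cong>\<^sub>G H \<longleftrightarrow>
     (\<exists>f. bij_betw f (fset (verts G)) (fset (verts H)) \<and>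
          (\<forall>u v. u |\<in>| verts G \<longrightarrow> v |\<in>| verts G \<longrightarrow>
                 ({|u, v|} |\<in>| edges G \<longleftrightarrow> {|f u, f v|} |\<in>| edges H)))"

definition induced_subgraph :: "'a graph \<Rightarrow> 'a graph \<Rightarrow> bool" where
  "induced_subgraph H G \<longleftrightarrow>
     verts H |\<subseteq>| verts G \<and> edges H = ffilter (\<lambda>e. e |\<subseteq>| verts H) (edges G)"

definition is_cycle :: "nat \<Rightarrow> 'a graph \<Rightarrow> bool" where
  "is_cycle n H \<longleftrightarrow> 3 \<le> n \<and>
     (\<exists>c. length c = n \<and> distinct c \<and> fset (verts H) = set c \<and>
          fset (edges H) = (\<lambda>i. {|c ! i, c ! (Suc i mod n)|}) ` {..<n})"


section \<open>The pentagon graph\<close>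

definition pentagons :: "'a graph \<Rightarrow> 'a graph set" where
  "pentagons G = {H. induced_subgraph H G \<and> is_cycle 5 H}"

text \<open>
  The sets under \<open>Abs_fset\<close> are finite; see \<open>verts_pentagon_graph\<close> and
  \<open>edges_pentagon_graph\<close> below.
\<close>

definition pentagon_graph :: "'a graph \<Rightarrow> 'a graph graph" where
  "pentagon_graph G = Graph
     (Abs_fset (pentagons G))
     (Abs_fset {{|H, K|} | H K. H \<in> pentagons G \<and> K \<in> pentagons G \<and> H \<noteq> K \<and>
                                edges H |\<inter>| edges K \<noteq> {||}})"

lemma finite_pentagons: "finite (pentagons G)"
proof (rule finite_subset)
  show "pentagons G \<subseteq> (\<lambda>(V, E). Graph V E) ` (fset (fPow (verts G)) \<times> fset (fPow (edges G)))"
  proof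
    fix H assume "H \<in> pentagons G"
    then have "verts H |\<subseteq>| verts G" "edges H |\<subseteq>| edges G"
      by (auto simp: pentagons_def induced_subgraph_def)
    then show "H \<in> (\<lambda>(V, E). Graph V E) ` (fset (fPow (verts G)) \<times> fset (fPow (edges G)))"
      by (intro image_eqI[where x = "(verts H, edges H)"]) auto
  qed
qed simp

lemma verts_pentagon_graph: "fset (verts (pentagon_graph G)) = pentagons G"
  by (simp add: pentagon_graph_def Abs_fset_inverse finite_pentagons)

lemma edges_pentagon_graph:
  "fset (edges (pentagon_graph G)) =
     {{|H, K|} | H K. H \<in> pentagons G \<and> K \<in> pentagons G \<and> H \<noteq> K \<and>
                      edges H |\<inter>| edges K \<noteq> {||}}"
  (is "_ = ?E")
proof -
  have "?E \<subseteq> (\<lambda>(H, K). {|H, K|}) ` (pentagons G \<times> pentagons G)"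
    by auto
  then have "finite ?E"
    by (rule finite_subset) (simp add: finite_pentagons)
  then show ?thesis
    by (simp add: pentagon_graph_def Abs_fset_inverse)
qed

lemma simple_pentagon_graph: "simple_graph (pentagon_graph G)"
  unfolding simple_graph_def
proof (intro allI impI)
  fix e assume "e |\<in>| edges (pentagon_graph G)"
  then have "e \<in> {{|H, K|} | H K. H \<in> pentagons G \<and> K \<in> pentagons G \<and> H \<noteq> K \<and>
                      edges H |\<inter>| edges K \<noteq> {||}}"
    by (simp only: edges_pentagon_graph)
  then obtain H K where "e = {|H, K|}" "H \<in> pentagons G" "K \<in> pentagons G" "H \<noteq> K"
    by blast
  then show "e |\<subseteq>| verts (pentagon_graph G) \<and> fcard e = 2"
    by (auto simp: verts_pentagon_graph fcard_finsert_disjoint)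
qed


section \<open>Iterates\<close>

text \<open>
  The vertices of \<open>pentagon_graph G\<close> have a larger type than those of \<open>G\<close>. To iterate the
  construction inside one type, a vertex is either an original vertex or a subgraph of a graph
  on such vertices. \<open>Base\<close> and \<open>Sub\<close> are injective, so relabelling by them changes a graph only
  up to isomorphism; see \<open>pentagon_iterate_0\<close> and \<open>pentagon_iterate_Suc\<close>.
\<close>

datatype 'a vertex = Base 'a | Sub "'a vertex graph"

definition pentagon_iterate :: "nat \<Rightarrow> 'a graph \<Rightarrow> 'a vertex graph" where
  "pentagon_iterate n G = ((\<lambda>H. map_graph Sub (pentagon_graph H)) ^^ n) (map_graph Base G)"

lemma graph_iso_map_graph:
  assumes "inj f"
  shows "map_graph f G \<cong>\<^sub>G G" "G \<cong>\<^sub>G map_graph f G"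
proof -
  obtain V E where G: "G = Graph V E" by (cases G)
  have inj: "inj ((|`|) f)"
    using assms by (rule fset.inj_map)
  have e: "{|f u, f v|} |\<in>| (|`|) f |`| E \<longleftrightarrow> {|u, v|} |\<in>| E" for u v
    using inj_image_mem_iff[OF inj, of "{|u, v|}" "fset E"] by simp
  show "G \<cong>\<^sub>G map_graph f G"
    unfolding graph_iso_def G
    using assms e by (intro exI[of _ f]) (auto simp: bij_betw_def intro: inj_on_subset)
  have "bij_betw (inv f) (f ` fset V) (fset V)"
    using assms by (auto simp: bij_betw_def inj_on_def image_image)
  then show "map_graph f G \<cong>\<^sub>G G"
    unfolding graph_iso_def G
    using assms e by (intro exI[of _ "inv f"]) clarsimp
qed

lemma pentagon_iterate_0: "pentagon_iterate 0 G \<cong>\<^sub>G G"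
  by (simp add: pentagon_iterate_def graph_iso_map_graph inj_def)

lemma pentagon_iterate_Suc:
  "pentagon_iterate (Suc n) G \<cong>\<^sub>G pentagon_graph (pentagon_iterate n G)"
  by (simp add: pentagon_iterate_def graph_iso_map_graph inj_def)


section \<open>Graphs of polytopes\<close>

text \<open>
  The graph of a polytope is its 1-skeleton. Every edge of a polytope is the segment joining two
  of its vertices, so it is recorded as the pair of its endpoints. The sets under \<open>Abs_fset\<close>
  are finite if \<open>P\<close> is a polytope; see \<open>verts_skeleton_graph\<close> and \<open>edges_skeleton_graph\<close>.
\<close>

definition skeleton_graph :: "'a::euclidean_space set \<Rightarrow> 'a graph" where
  "skeleton_graph P = Graph
     (Abs_fset {v. v extreme_point_of P})
     (Abs_fset {{|u, v|} | u v. closed_segment u v edge_of P})"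

lemma
  assumes "polytope P"
  shows verts_skeleton_graph: "fset (verts (skeleton_graph P)) = {v. v extreme_point_of P}"
    and edges_skeleton_graph:
      "fset (edges (skeleton_graph P)) = {{|u, v|} | u v. closed_segment u v edge_of P}"
        (is "_ = ?E")
proof -
  have fin: "finite {v. v extreme_point_of P}"
    using assms finite_polyhedron_extreme_points polytope_imp_polyhedron by blast
  then show "fset (verts (skeleton_graph P)) = {v. v extreme_point_of P}"
    by (simp add: skeleton_graph_def Abs_fset_inverse)
  have ext: "u extreme_point_of P" "v extreme_point_of P"
    if "closed_segment u v edge_of P" for u v
    using that unfolding edge_of_def
    by (meson extreme_point_of_face extreme_point_of_segment)+
  have "?E \<subseteq> (\<lambda>(u, v). {|u, v|}) ` ({v. v extreme_point_of P} \<times> {v. v extreme_point_of P})"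
    using ext by (auto simp: image_iff)
  then have "finite ?E"
    by (rule finite_subset) (simp add: fin)
  then show "fset (edges (skeleton_graph P)) = ?E"
    by (simp add: skeleton_graph_def Abs_fset_inverse)
qed

lemma simple_skeleton_graph:
  assumes "polytope P"
  shows "simple_graph (skeleton_graph P)"
  unfolding simple_graph_def
proof (intro allI impI)
  fix e assume "e |\<in>| edges (skeleton_graph P)"
  then have "e \<in> {{|u, v|} | u v. closed_segment u v edge_of P}"
    by (simp only: edges_skeleton_graph[OF assms])
  then obtain u v where e: "e = {|u, v|}" and uv: "closed_segment u v edge_of P"
    by blast
  have "u \<noteq> v"
    using uv by (auto simp: edge_of_def)
  moreover have "u extreme_point_of P" "v extreme_point_of P"
    using uv unfolding edge_of_def
    by (meson extreme_point_of_face extreme_point_of_segment)+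
  ultimately show "e |\<subseteq>| verts (skeleton_graph P) \<and> fcard e = 2"
    by (auto simp: e verts_skeleton_graph[OF assms] fcard_finsert_disjoint)
qed


section \<open>The regular dodecahedron and icosahedron\<close>

text \<open>
  Standard coordinates centred at the origin: for the icosahedron the cyclic permutations of
  (0, \<plusminus>1, \<plusminus>\<phi>); for the dodecahedron (\<plusminus>1, \<plusminus>1, \<plusminus>1) and the cyclic
  permutations of (0, \<plusminus>1/\<phi>, \<plusminus>\<phi>).
\<close>

definition golden :: real  (\<open>\<phi>\<close>) where
  "\<phi> = (1 + sqrt 5) / 2"

definition sgns :: "real set" where
  "sgns = {-1, 1}"

definition icosahedron :: "(real ^ 3) set" where
  "icosahedron = convex hull
     (\<Union>s\<in>sgns. \<Union>t\<in>sgns.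
        {vector [0, s, t * \<phi>], vector [s, t * \<phi>, 0], vector [t * \<phi>, 0, s]})"

definition dodecahedron :: "(real ^ 3) set" where
  "dodecahedron = convex hull
     ((\<Union>r\<in>sgns. \<Union>s\<in>sgns. \<Union>t\<in>sgns. {vector [r, s, t]}) \<union>
      (\<Union>s\<in>sgns. \<Union>t\<in>sgns.
        {vector [0, s / \<phi>, t * \<phi>], vector [s / \<phi>, t * \<phi>, 0], vector [t * \<phi>, 0, s / \<phi>]}))"

lemma polytope_icosahedron: "polytope icosahedron"
  unfolding icosahedron_def sgns_def by (intro polytope_convex_hull) simp

lemma polytope_dodecahedron: "polytope dodecahedron"
  unfolding dodecahedron_def sgns_def by (intro polytope_convex_hull) simp

definition dodecahedron_graph :: "(real ^ 3) graph" where
  "dodecahedron_graph = skeleton_graph dodecahedron"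

definition icosahedron_graph :: "(real ^ 3) graph" where
  "icosahedron_graph = skeleton_graph icosahedron"

end

(*
  The vertices of either polytope lie on a sphere around the origin. If the inner product of two
  vertices u, v is the largest possible one, then the functional u + v attains its maximum on the
  vertices exactly at u and v, so uv is an edge. Any other segment uv meets a segment from a further
  vertex to another point of the polytope and hence is no face. This identifies both skeletons with
  explicit finite graphs.

  The induced 5-cycles of the dodecahedron graph are its 12 faces, of which adjacent ones share an
  edge. Those of the icosahedron graph are the 12 links of vertices; two links share an edge if and
  only if the vertices have distance 2, and the distance-2 graph of the icosahedron is again the
  icosahedron graph (Galois conjugation of the golden ratio exchanges the two relations).

  Since isomorphic simple graphs have isomorphic pentagon graphs, every iterate after the first is
  the icosahedron graph.
*)

theory Submission
  imports Defs
begin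

section \<open>Skeletons of polytopes inscribed in a sphere\<close>

lemma pair_fset_eq_iff: "{|u, v|} = {|w, z|} \<longleftrightarrow> u = w \<and> v = z \<or> u = z \<and> v = w"
  by (auto simp: fset_eq_iff)

text \<open>The hyperplane \<open>a \<bullet> x = b\<close> contains the affine hull of
  \<open>F\<close>, while the hull of the remaining points lies strictly below it. The two are
  disjoint, which is the criterion of \<open>face_of_convex_hulls\<close>.\<close>

lemma face_of_convex_hull_supporting:
  fixes S :: "'a::euclidean_space set"
  assumes "finite S" "F \<subseteq> S"
    and eq: "\<And>x. x \<in> F \<Longrightarrow> a \<bullet> x = b" and less: "\<And>x. x \<in> S - F \<Longrightarrow> a \<bullet> x < b"
  shows "convex hull F face_of convex hull S"
proof (rule face_of_convex_hulls[OF assms(1,2)])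
  have "affine hull F \<subseteq> {x. a \<bullet> x = b}"
    using eq by (intro hull_minimal) (auto simp: affine_hyperplane)
  moreover have "convex hull (S - F) \<subseteq> {x. a \<bullet> x < b}"
    using less by (intro hull_minimal) (auto simp: convex_halfspace_lt)
  ultimately show "affine hull F \<inter> convex hull (S - F) = {}"
    by fastforce
qed

text \<open>
  A suitable multiple of the common value of the two sides lies on the segment \<open>uv\<close> and also strictly
  between \<open>x\<close> and a point of \<open>P\<close>, so a face containing \<open>uv\<close> would contain \<open>x\<close>.
\<close>

lemma not_face_of_crossing:
  fixes u v x y :: "'a::real_vector"
  assumes "convex P" "0 \<in> P" "u \<in> P" "v \<in> P" "y \<in> P" "x extreme_point_of P" "x \<noteq> u" "x \<noteq> v"
    and eq: "\<alpha> *\<^sub>R u + \<beta> *\<^sub>R v = \<gamma> *\<^sub>R x + \<delta> *\<^sub>R y"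
    and pos: "\<alpha> > 0" "\<beta> > 0" "\<gamma> > 0" "\<delta> > 0" "\<gamma> + \<delta> \<le> \<alpha> + \<beta>"
  shows "\<not> closed_segment u v face_of P"
proof
  assume face: "closed_segment u v face_of P"
  define s where "s = \<alpha> + \<beta>"
  define m where "m = (\<alpha> / s) *\<^sub>R u + (\<beta> / s) *\<^sub>R v"
  \<comment> \<open>\<open>y\<close> is shrunk towards the origin so that
    \<open>\<gamma> / s\<close> and \<open>(s - \<gamma>) / s\<close> become the weights of
    \<open>x\<close> and \<open>z\<close>. The factor is at most 1 because
    \<open>\<gamma> + \<delta> \<le> s\<close>, so \<open>z\<close> stays in
    \<open>P\<close>.\<close>
  define z where "z = (\<delta> / (s - \<gamma>)) *\<^sub>R y"
  have s: "s > 0" "s - \<gamma> > 0" "\<delta> \<le> s - \<gamma>" using pos by (auto simp: s_def)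
  have "z \<in> P"
  proof -
    have "(\<delta> / (s - \<gamma>)) *\<^sub>R y + (1 - \<delta> / (s - \<gamma>)) *\<^sub>R 0 \<in> P"
      by (rule convexD[OF \<open>convex P\<close> \<open>y \<in> P\<close> \<open>0 \<in> P\<close>]) (use s pos in auto)
    then show ?thesis by (simp add: z_def)
  qed
  have "x \<in> P" using \<open>x extreme_point_of P\<close> by (simp add: extreme_point_of_def)
  have m_uv: "m \<in> closed_segment u v"
    unfolding in_segment using s pos
    by (intro exI[of _ "\<beta> / s"]) (auto simp: m_def s_def field_simps add_divide_distrib[symmetric])
  have m_xz: "m = (1 - (s - \<gamma>) / s) *\<^sub>R x + ((s - \<gamma>) / s) *\<^sub>R z"
  proof -
    have "m = (1 / s) *\<^sub>R (\<alpha> *\<^sub>R u + \<beta> *\<^sub>R v)"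
      by (simp add: m_def scaleR_add_right)
    then have "m = (\<gamma> / s) *\<^sub>R x + (\<delta> / s) *\<^sub>R y"
      by (simp add: eq scaleR_add_right)
    moreover have "(s - \<gamma>) / s * (\<delta> / (s - \<gamma>)) = \<delta> / s"
      using s by simp
    ultimately show ?thesis using s by (simp add: z_def diff_divide_distrib)
  qed
  have "x \<in> closed_segment u v"
  \<comment> \<open>An open segment with equal ends is empty, so the face property gives nothing if
    \<open>x = z\<close>; but then \<open>m\<close> is \<open>x\<close> itself.\<close>
  proof (cases "x = z")
    case True
    then have "m = x" using m_xz by (simp add: scaleR_add_left[symmetric])
    then show ?thesis using m_uv by simp
  next
    case False
    then have "m \<in> open_segment x z"
      unfolding in_segment using m_xz s pos by (intro conjI exI[of _ "(s - \<gamma>) / s"]) auto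
    then show ?thesis
      using face_ofD[OF face _ \<open>x \<in> P\<close> \<open>z \<in> P\<close> m_uv] by blast
  qed
  then have "x \<in> open_segment u v" using assms(7,8) by (simp add: open_segment_def)
  then show False using assms(3,4,6) by (auto simp: extreme_point_of_def)
qed

text \<open>The functional given by \<open>u\<close> attains its maximum over \<open>S\<close> only
  at \<open>u\<close>; for points on a sphere its level set there is the tangent hyperplane.\<close>

lemma extreme_point_of_convex_hull_sphere:
  fixes S :: "'a::euclidean_space set"
  assumes "finite S" "u \<in> S" "u \<bullet> u = r"
    and "\<And>v. v \<in> S \<Longrightarrow> u \<noteq> v \<Longrightarrow> u \<bullet> v < r"
  shows "u extreme_point_of convex hull S"
proof -
  have "convex hull {u} face_of convex hull S"
    using assms by (intro face_of_convex_hull_supporting[where a = u and b = r]) auto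
  then show ?thesis by (simp add: face_of_singleton)
qed

text \<open>\<open>adj\<close> asks for a certificate of either answer: adjacent vertices attain the
  maximal inner product \<open>c\<close>, and a non-adjacent pair spans a segment that is no
  face.\<close>

lemma skeleton_convex_hull:
  fixes S :: "'a::euclidean_space set"
  assumes "finite S"
    and norm: "\<And>u. u \<in> S \<Longrightarrow> u \<bullet> u = r"
    and le: "\<And>u v. u \<in> S \<Longrightarrow> v \<in> S \<Longrightarrow> u \<noteq> v \<Longrightarrow> u \<bullet> v \<le> c" and "c < r"
    and adj: "\<And>u v. u \<in> S \<Longrightarrow> v \<in> S \<Longrightarrow> u \<noteq> v \<Longrightarrow>
      u \<bullet> v = c \<and> A u v \<or> \<not> closed_segment u v face_of convex hull S \<and> \<not> A u v"
    and irrefl: "\<And>u. u \<in> S \<Longrightarrow> \<not> A u u"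
  shows "fset (verts (skeleton_graph (convex hull S))) = S"
    and "u \<in> S \<Longrightarrow> v \<in> S \<Longrightarrow> {|u, v|} |\<in>| edges (skeleton_graph (convex hull S)) \<longleftrightarrow> A u v"
proof -
  have poly: "polytope (convex hull S)"
    using \<open>finite S\<close> by (rule polytope_convex_hull)
  have ext: "u extreme_point_of convex hull S" if "u \<in> S" for u
    by (rule extreme_point_of_convex_hull_sphere[OF \<open>finite S\<close> that norm[OF that]])
      (use le[OF that] \<open>c < r\<close> in force)
  then show "fset (verts (skeleton_graph (convex hull S))) = S"
    using extreme_point_of_convex_hull by (auto simp: verts_skeleton_graph[OF poly])
  assume uv: "u \<in> S" "v \<in> S"
  have edge: "closed_segment u v edge_of convex hull S \<longleftrightarrow> A u v" if uv: "u \<in> S" "v \<in> S" for u v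
  proof
    assume "closed_segment u v edge_of convex hull S"
    then have "closed_segment u v face_of convex hull S" "u \<noteq> v"
      by (auto simp: edge_of_def)
    then show "A u v" using adj uv by blast
  next
    assume A: "A u v"
    then have [simp]: "u \<noteq> v" using irrefl uv by auto
    then have c: "u \<bullet> v = c" "v \<bullet> u = c" using adj[OF uv \<open>u \<noteq> v\<close>] A by (auto simp: inner_commute)
    \<comment> \<open>The functional \<open>u + v\<close> is \<open>r + c\<close> at both ends and
      at most \<open>2 * c\<close> at every other vertex, which is smaller because
      \<open>c < r\<close>.\<close>
    have "convex hull {u, v} face_of convex hull S"
    proof (rule face_of_convex_hull_supporting[OF \<open>finite S\<close>, where a = "u + v" and b = "r + c"])
      show "(u + v) \<bullet> x < r + c" if "x \<in> S - {u, v}" for x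
        using le[of u x] le[of v x] that uv \<open>c < r\<close> by (auto simp: inner_add_left)
    qed (use uv c norm in \<open>auto simp: inner_add_left\<close>)
    then show "closed_segment u v edge_of convex hull S"
      by (simp add: edge_of_def segment_convex_hull aff_dim_convex_hull)
  qed
  have "{|u, v|} |\<in>| edges (skeleton_graph (convex hull S)) \<longleftrightarrow>
      closed_segment u v edge_of convex hull S"
    by (auto simp: edges_skeleton_graph[OF poly] pair_fset_eq_iff closed_segment_commute)
  then show "{|u, v|} |\<in>| edges (skeleton_graph (convex hull S)) \<longleftrightarrow> A u v"
    using edge uv by simp
qed

section \<open>Integral coordinates over the golden ratio\<close>

text \<open>
  The pair \<open>(a, b)\<close> stands for \<open>a + b\<phi>\<close>, so that all coordinates and inner products of
  vertices are integral data.
\<close>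

type_synonym coords = "(int \<times> int) \<times> (int \<times> int) \<times> (int \<times> int)"

text \<open>Tables are association lists with integer keys, so that the finite checks can be
  evaluated. Off the keys the value is unspecified.\<close>

definition entry :: "(int \<times> 'b) list \<Rightarrow> int \<Rightarrow> 'b" where
  "entry T i = the (map_of T i)"

definition nbrs_wf :: "(int \<times> int list) list \<Rightarrow> bool" where
  "nbrs_wf N \<longleftrightarrow> (\<forall>i\<in>set (map fst N). \<forall>j\<in>set (entry N i).
     j \<noteq> i \<and> j \<in> set (map fst N) \<and> i \<in> set (entry N j))"

text \<open>Sufficient for \<open>a + b\<phi> \<ge> 0\<close>, since \<open>\<phi> \<ge> 1\<close>; not necessary.\<close>

definition zphi_nonneg :: "int \<times> int \<Rightarrow> bool" where
  "zphi_nonneg x \<longleftrightarrow> 0 \<le> snd x \<and> 0 \<le> fst x + snd x"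

text \<open>The product of \<open>a + b\<phi>\<close> and \<open>c + d\<phi>\<close>, reduced by
  \<open>\<phi>\<^sup>2 = \<phi> + 1\<close>.\<close>

definition zphi_mult :: "int \<times> int \<Rightarrow> int \<times> int \<Rightarrow> int \<times> int" where
  "zphi_mult x y = (fst x * fst y + snd x * snd y, fst x * snd y + snd x * fst y + snd x * snd y)"

definition coords_inner :: "coords \<Rightarrow> coords \<Rightarrow> int \<times> int" where
  "coords_inner p q = zphi_mult (fst p) (fst q) + zphi_mult (fst (snd p)) (fst (snd q)) +
     zphi_mult (snd (snd p)) (snd (snd q))"

definition coords_phi :: "coords \<Rightarrow> coords" where
  "coords_phi p = (zphi_mult (0, 1) (fst p), zphi_mult (0, 1) (fst (snd p)),
     zphi_mult (0, 1) (snd (snd p)))"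

text \<open>
  The alternatives say \<open>u + v = x + y\<close>, \<open>u + \<phi>v = \<phi>x + y\<close>, \<open>\<phi>u + v = \<phi>x + y\<close> and
  \<open>\<phi>\<^sup>2(u + v) = x + y\<close> for some \<open>y\<close> in \<open>C\<close>. The middle two hold for a diagonal \<open>uv\<close> of a
  regular pentagon with vertices \<open>x\<close>, \<open>y\<close>: the diagonal \<open>xy\<close> crosses it in the golden ratio.
\<close>

definition coords_cross :: "coords set \<Rightarrow> coords \<Rightarrow> coords \<Rightarrow> bool" where
  "coords_cross C u v \<longleftrightarrow> (\<exists>x\<in>C. x \<noteq> u \<and> x \<noteq> v \<and>
     (u + v - x \<in> C \<or> u + coords_phi (v - x) \<in> C \<or> v + coords_phi (u - x) \<in> C \<or>
      coords_phi (coords_phi (u + v)) - x \<in> C))"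

text \<open>\<open>r\<close> is the squared circumradius and \<open>c\<close> the inner product of
  adjacent vertices. The antipodal pair places the origin in the convex hull, as the crossing
  argument requires.\<close>

definition skeleton_table ::
  "(int \<times> int list) list \<Rightarrow> (int \<times> coords) list \<Rightarrow> int \<times> int \<Rightarrow> int \<times> int \<Rightarrow> bool" where
  "skeleton_table N T r c \<longleftrightarrow> (\<exists>p\<in>set (map snd T). - p \<in> set (map snd T)) \<and>
     (\<forall>i\<in>set (map fst N). \<forall>j\<in>set (map fst N).
        if i = j then coords_inner (entry T i) (entry T j) = r
        else if j \<in> set (entry N i) then coords_inner (entry T i) (entry T j) = c
        else zphi_nonneg (c - coords_inner (entry T i) (entry T j)) \<and>
             coords_cross (set (map snd T)) (entry T i) (entry T j))"

section \<open>The golden ratio and the evaluation of integral coordinates\<close>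

lemma golden_square: "\<phi> * \<phi> = \<phi> + 1"
  by (simp add: golden_def field_simps)

lemma golden_gt_1: "1 < \<phi>" and golden_less_2: "\<phi> < 2"
proof -
  have "sqrt 1 < sqrt 5" "sqrt 5 < sqrt 9"
    by (simp_all only: real_sqrt_less_iff)
  then show "1 < \<phi>" "\<phi> < 2" by (auto simp: golden_def real_sqrt_eq_iff)
qed

text \<open>Makes the dodecahedron coordinates \<open>s / \<phi>\<close> integral, as multiples of
  \<open>\<phi> - 1\<close>.\<close>

lemma inverse_golden: "1 / \<phi> = \<phi> - 1"
  using golden_square golden_gt_1 by (simp add: field_simps)

definition zphi_real :: "int \<times> int \<Rightarrow> real" where
  "zphi_real x = of_int (fst x) + of_int (snd x) * \<phi>"

definition coords_vec :: "coords \<Rightarrow> real ^ 3" where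
  "coords_vec p =
     vector [zphi_real (fst p), zphi_real (fst (snd p)), zphi_real (snd (snd p))]"

lemma zphi_real_simps:
  "zphi_real (x + y) = zphi_real x + zphi_real y"
  "zphi_real (x - y) = zphi_real x - zphi_real y"
  "zphi_real (- x) = - zphi_real x"
  by (simp_all add: zphi_real_def algebra_simps)

lemma zphi_real_mult: "zphi_real (zphi_mult x y) = zphi_real x * zphi_real y"
proof -
  have "zphi_real x * zphi_real y = of_int (fst x * fst y) +
      of_int (fst x * snd y + snd x * fst y) * \<phi> + of_int (snd x * snd y) * (\<phi> * \<phi>)"
    by (simp add: zphi_real_def algebra_simps)
  then show ?thesis
    by (simp add: golden_square zphi_real_def zphi_mult_def algebra_simps)
qed

lemma zphi_nonneg: "zphi_nonneg x \<Longrightarrow> 0 \<le> zphi_real x"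
proof -
  assume x: "zphi_nonneg x"
  \<comment> \<open>\<open>a + b\<phi>\<close> is split as \<open>(a + b) + b(\<phi> - 1)\<close>, a
    sum of nonnegative terms.\<close>
  have "0 \<le> real_of_int (fst x + snd x) + of_int (snd x) * (\<phi> - 1)"
    using x golden_gt_1 unfolding zphi_nonneg_def by (intro add_nonneg_nonneg mult_nonneg_nonneg) auto
  then show ?thesis by (simp add: zphi_real_def algebra_simps)
qed

lemma coords_vec_simps:
  "coords_vec (p + q) = coords_vec p + coords_vec q"
  "coords_vec (p - q) = coords_vec p - coords_vec q"
  "coords_vec (- p) = - coords_vec p"
  by (simp_all add: coords_vec_def zphi_real_simps vec_eq_iff forall_3)

lemma coords_vec_phi: "coords_vec (coords_phi p) = \<phi> *\<^sub>R coords_vec p"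
  by (simp add: coords_vec_def coords_phi_def zphi_real_mult vec_eq_iff forall_3)
    (simp add: zphi_real_def)

lemma coords_vec_inner: "coords_vec p \<bullet> coords_vec q = zphi_real (coords_inner p q)"
  by (simp add: coords_vec_def coords_inner_def zphi_real_simps zphi_real_mult inner_vec_def sum_3)

text \<open>Each alternative of \<open>coords_cross\<close> is a linear relation to which
  \<open>not_face_of_crossing\<close> applies. Injectivity of \<open>coords_vec\<close> on
  \<open>C\<close> ensures that \<open>x\<close> differs from both ends also as a vector.\<close>

lemma coords_cross_not_face:
  assumes "convex P" "0 \<in> P"
    and ext: "\<And>x. x \<in> C \<Longrightarrow> coords_vec x extreme_point_of P"
    and inj: "inj_on coords_vec C"
    and "u \<in> C" "v \<in> C" and cross: "coords_cross C u v"
  shows "\<not> closed_segment (coords_vec u) (coords_vec v) face_of P"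
proof -
  have P: "coords_vec x \<in> P" if "x \<in> C" for x
    using ext[OF that] by (simp add: extreme_point_of_def)
  from cross obtain x where x: "x \<in> C" "x \<noteq> u" "x \<noteq> v" and
    y: "u + v - x \<in> C \<or> u + coords_phi (v - x) \<in> C \<or> v + coords_phi (u - x) \<in> C \<or>
      coords_phi (coords_phi (u + v)) - x \<in> C"
    by (auto simp: coords_cross_def)
  have ne: "coords_vec x \<noteq> coords_vec u" "coords_vec x \<noteq> coords_vec v"
    using x inj assms(5,6) by (auto simp: inj_on_eq_iff)
  have crossing: ?thesis
    if "y \<in> C" "\<alpha> > 0" "\<beta> > 0" "\<gamma> > 0" "\<delta> > 0" "\<gamma> + \<delta> \<le> \<alpha> + \<beta>"
      "\<alpha> *\<^sub>R coords_vec u + \<beta> *\<^sub>R coords_vec v = \<gamma> *\<^sub>R coords_vec x + \<delta> *\<^sub>R coords_vec y"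
    for y \<alpha> \<beta> \<gamma> \<delta>
    by (rule not_face_of_crossing[OF assms(1,2) _ _ _ ext ne that(7)]) (use that x assms(5,6) P in auto)
  note simps = coords_vec_simps coords_vec_phi algebra_simps
  from y show ?thesis
  proof (elim disjE)
    assume "u + v - x \<in> C"
    then show ?thesis
      by (rule crossing[of _ 1 1 1 1]) (auto simp: simps)
  next
    assume "u + coords_phi (v - x) \<in> C"
    then show ?thesis
      by (rule crossing[of _ 1 \<phi> \<phi> 1]) (use golden_gt_1 in \<open>auto simp: simps\<close>)
  next
    assume "v + coords_phi (u - x) \<in> C"
    then show ?thesis
      by (rule crossing[of _ \<phi> 1 \<phi> 1]) (use golden_gt_1 in \<open>auto simp: simps\<close>)
  next
    \<comment> \<open>In the other three cases both sides have the same total weight. Here the left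
      side has \<open>2\<phi>\<^sup>2\<close> and the right side 2; the origin takes up the
      difference.\<close>
    assume "coords_phi (coords_phi (u + v)) - x \<in> C"
    then show ?thesis
      by (rule crossing[of _ "\<phi> * \<phi>" "\<phi> * \<phi>" 1 1])
        (use golden_gt_1 in \<open>auto simp: simps golden_square\<close>)
  qed
qed

section \<open>Graphs given by neighbour tables\<close>

lemma entry_image:
  assumes "distinct (map fst T)"
  shows "entry T ` set (map fst T) = set (map snd T)"
proof -
  have "entry T i = x" if "(i, x) \<in> set T" for i x
    using assms that by (simp add: entry_def)
  then show ?thesis by force
qed

definition adjacency_graph :: "(int \<times> int list) list \<Rightarrow> int graph" where
  "adjacency_graph N = Graph (fset_of_list (map fst N))
     (fset_of_list [{|i, j|}. i \<leftarrow> map fst N, j \<leftarrow> entry N i])"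

lemma verts_adjacency_graph: "fset (verts (adjacency_graph N)) = set (map fst N)"
  by (simp add: adjacency_graph_def fset_of_list.rep_eq)

lemma edges_adjacency_graph:
  "fset (edges (adjacency_graph N)) =
     {{|i, j|} | i j. i \<in> set (map fst N) \<and> j \<in> set (entry N i)}"
  by (auto simp: adjacency_graph_def fset_of_list.rep_eq)

lemma edge_adjacency_graph_iff:
  assumes "nbrs_wf N"
  shows "{|i, j|} |\<in>| edges (adjacency_graph N) \<longleftrightarrow> i \<in> set (map fst N) \<and> j \<in> set (entry N i)"
proof -
  have "{|i, j|} |\<in>| edges (adjacency_graph N) \<longleftrightarrow>
      i \<in> set (map fst N) \<and> j \<in> set (entry N i) \<or> j \<in> set (map fst N) \<and> i \<in> set (entry N j)"
    by (simp only: edges_adjacency_graph mem_Collect_eq pair_fset_eq_iff) metis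
  also have "\<dots> \<longleftrightarrow> i \<in> set (map fst N) \<and> j \<in> set (entry N i)"
    using assms unfolding nbrs_wf_def by metis
  finally show ?thesis .
qed

lemma simple_adjacency_graph:
  assumes "nbrs_wf N"
  shows "simple_graph (adjacency_graph N)"
  unfolding simple_graph_def
proof (intro allI impI)
  fix e assume "e |\<in>| edges (adjacency_graph N)"
  then obtain i j where "e = {|i, j|}" "i \<in> set (map fst N)" "j \<in> set (entry N i)"
    by (auto simp: edges_adjacency_graph)
  then show "e |\<subseteq>| verts (adjacency_graph N) \<and> fcard e = 2"
    using assms by (fastforce simp: nbrs_wf_def verts_adjacency_graph fcard_finsert_disjoint)
qed

text \<open>The table supplies the hypotheses of \<open>skeleton_convex_hull\<close> for the vectors
  \<open>f i\<close>. Extremality of these vectors comes first, since a crossing excludes a face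
  only through an extreme point. \<open>cr\<close> is a separate hypothesis because
  \<open>zphi_nonneg\<close> yields only weak inequalities.\<close>

lemma adjacency_graph_iso_skeleton:
  assumes "nbrs_wf N" "map fst T = map fst N" "distinct (map fst N)"
    and table: "skeleton_table N T r c" and cr: "zphi_real c < zphi_real r"
  shows "adjacency_graph N \<cong>\<^sub>G skeleton_graph (convex hull (coords_vec ` set (map snd T)))"
proof -
  define K where "K = set (map fst N)"
  define C where "C = set (map snd T)"
  define f where "f i = coords_vec (entry T i)" for i
  define S where "S = coords_vec ` C"
  define A where "A u v \<longleftrightarrow> (\<exists>i\<in>K. \<exists>j\<in>set (entry N i). u = f i \<and> v = f j)" for u v
  have C: "C = entry T ` K"
    using entry_image[of T] assms(2,3) by (simp add: C_def K_def)
  have S: "S = f ` K" by (auto simp: S_def C f_def)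
  have "finite S" by (simp add: S_def C_def)
  have tab: "if i = j then coords_inner (entry T i) (entry T j) = r
        else if j \<in> set (entry N i) then coords_inner (entry T i) (entry T j) = c
        else zphi_nonneg (c - coords_inner (entry T i) (entry T j)) \<and>
             coords_cross C (entry T i) (entry T j)" if "i \<in> K" "j \<in> K" for i j
    using table that unfolding skeleton_table_def K_def C_def by blast
  have norm: "f i \<bullet> f i = zphi_real r" if "i \<in> K" for i
    using tab[OF that that] by (simp add: f_def coords_vec_inner)
  have le: "f i \<bullet> f j \<le> zphi_real c" if "i \<in> K" "j \<in> K" "i \<noteq> j" for i j
    using tab[OF that(1,2)] that(3) zphi_nonneg
    by (fastforce simp: f_def coords_vec_inner zphi_real_simps split: if_splits)
  \<comment> \<open>Distinct indices with the same vector would have an inner product equal to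
    \<open>r\<close> and at most \<open>c\<close>, against \<open>c < r\<close>.\<close>
  have inj: "inj_on f K"
  proof (rule inj_onI, rule ccontr)
    fix i j assume "i \<in> K" "j \<in> K" "f i = f j" "i \<noteq> j"
    then show False using norm[of i] le[of i j] cr by simp
  qed
  have injC: "inj_on coords_vec C"
    using inj by (auto simp: C f_def inj_on_def)
  have A: "A (f i) (f j) \<longleftrightarrow> j \<in> set (entry N i)" if "i \<in> K" "j \<in> K" for i j
    using that inj \<open>nbrs_wf N\<close> unfolding A_def nbrs_wf_def K_def inj_on_def by blast
  have "0 \<in> convex hull S"
  proof -
    obtain p where "p \<in> C" "- p \<in> C" using table unfolding skeleton_table_def C_def by blast
    then have "coords_vec p \<in> convex hull S" "- coords_vec p \<in> convex hull S"
      unfolding S_def by (metis coords_vec_simps(3) hull_inc imageI)+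
    then have "(1/2) *\<^sub>R coords_vec p + (1/2) *\<^sub>R (- coords_vec p) \<in> convex hull S"
      by (intro convexD convex_convex_hull) auto
    then show ?thesis by simp
  qed
  have ext: "f i extreme_point_of convex hull S" if "i \<in> K" for i
    by (rule extreme_point_of_convex_hull_sphere[OF \<open>finite S\<close> _ norm[OF that]])
      (use le[OF that] that cr in \<open>force simp: S\<close>)+
  have nonedge: "\<not> closed_segment (f i) (f j) face_of convex hull S"
    if "i \<in> K" "j \<in> K" "i \<noteq> j" "j \<notin> set (entry N i)" for i j
    unfolding f_def
    by (rule coords_cross_not_face[OF convex_convex_hull \<open>0 \<in> convex hull S\<close> _ injC])
      (use that tab[of i j] ext in \<open>auto simp: C f_def\<close>)
  have edge: "f i \<bullet> f j = zphi_real c" if "i \<in> K" "j \<in> K" "i \<noteq> j" "j \<in> set (entry N i)" for i j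
    using tab[OF that(1,2)] that(3,4) by (simp add: f_def coords_vec_inner)
  have le': "u \<bullet> v \<le> zphi_real c" if "u \<in> S" "v \<in> S" "u \<noteq> v" for u v
    using that le by (auto simp: S)
  have adj': "u \<bullet> v = zphi_real c \<and> A u v \<or>
      \<not> closed_segment u v face_of convex hull S \<and> \<not> A u v"
    if uv: "u \<in> S" "v \<in> S" "u \<noteq> v" for u v
  proof -
    obtain i j where "i \<in> K" "j \<in> K" "u = f i" "v = f j"
      using uv by (auto simp: S)
    moreover from this have "i \<noteq> j" using \<open>u \<noteq> v\<close> by auto
    ultimately show ?thesis using A[of i j] edge[of i j] nonedge[of i j] by blast
  qed
  have irrefl: "\<not> A u u" if "u \<in> S" for u
    using that A \<open>nbrs_wf N\<close> by (auto simp: S nbrs_wf_def K_def)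
  have norm': "u \<bullet> u = zphi_real r" if "u \<in> S" for u
    using that norm by (auto simp: S)
  have verts: "fset (verts (skeleton_graph (convex hull S))) = S"
    by (rule skeleton_convex_hull(1)[OF \<open>finite S\<close> norm' le' cr adj' irrefl])
  have edges: "{|f i, f j|} |\<in>| edges (skeleton_graph (convex hull S)) \<longleftrightarrow> A (f i) (f j)"
    if "i \<in> K" "j \<in> K" for i j
    by (rule skeleton_convex_hull(2)[OF \<open>finite S\<close> norm' le' cr adj' irrefl]) (use that in \<open>auto simp: S\<close>)
  have "bij_betw f K S" using inj by (simp add: bij_betw_def S)
  moreover have "{|i, j|} |\<in>| edges (adjacency_graph N) \<longleftrightarrow>
      {|f i, f j|} |\<in>| edges (skeleton_graph (convex hull S))" if "i \<in> K" "j \<in> K" for i j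
    using that A[OF that] edges[OF that]
    by (simp add: edge_adjacency_graph_iff[OF \<open>nbrs_wf N\<close>] K_def)
  ultimately show ?thesis
    unfolding graph_iso_def C_def[symmetric] S_def[symmetric] verts_adjacency_graph K_def[symmetric] verts
    by (intro exI[of _ f]) auto
qed

section \<open>Pentagon graphs of simple graphs\<close>

text \<open>The relation is arbitrary so that it can be adjacency in a graph or lookup in a
  neighbour table. A pentagon has ten such lists, one for each start and direction, hence vertex
  sets are compared later.\<close>

fun induced_pentagon :: "('a \<Rightarrow> 'a \<Rightarrow> bool) \<Rightarrow> 'a list \<Rightarrow> bool" where
  "induced_pentagon R [a, b, c, d, e] \<longleftrightarrow>
     distinct [a, b, c, d, e] \<and> R a b \<and> R b c \<and> R c d \<and> R d e \<and> R e a \<and>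
     \<not> R a c \<and> \<not> R a d \<and> \<not> R b d \<and> \<not> R b e \<and> \<not> R c e"
| "induced_pentagon R _ \<longleftrightarrow> False"

section \<open>Isomorphism and simplicity of graphs\<close>

lemma graph_iso_sym:
  assumes "G \<cong>\<^sub>G H"
  shows "H \<cong>\<^sub>G G"
proof -
  obtain f where bij: "bij_betw f (fset (verts G)) (fset (verts H))"
    and e: "\<And>u v. u |\<in>| verts G \<Longrightarrow> v |\<in>| verts G \<Longrightarrow>
      {|u, v|} |\<in>| edges G \<longleftrightarrow> {|f u, f v|} |\<in>| edges H"
    using assms by (auto simp: graph_iso_def)
  define g where "g = inv_into (fset (verts G)) f"
  have g: "bij_betw g (fset (verts H)) (fset (verts G))"
    unfolding g_def using bij by (rule bij_betw_inv_into)
  have "g u |\<in>| verts G" "f (g u) = u" if "u |\<in>| verts H" for u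
    using that g bij bij_betw_inv_into_right[OF bij] by (auto simp: g_def bij_betw_apply)
  then show ?thesis
    unfolding graph_iso_def using g e by (intro exI[of _ g]) auto
qed

lemma graph_iso_trans [trans]:
  assumes "G \<cong>\<^sub>G H" "H \<cong>\<^sub>G K"
  shows "G \<cong>\<^sub>G K"
proof -
  obtain f where f: "bij_betw f (fset (verts G)) (fset (verts H))"
    and ef: "\<And>u v. u |\<in>| verts G \<Longrightarrow> v |\<in>| verts G \<Longrightarrow>
      {|u, v|} |\<in>| edges G \<longleftrightarrow> {|f u, f v|} |\<in>| edges H"
    using assms(1) by (auto simp: graph_iso_def)
  obtain g where g: "bij_betw g (fset (verts H)) (fset (verts K))"
    and eg: "\<And>u v. u |\<in>| verts H \<Longrightarrow> v |\<in>| verts H \<Longrightarrow>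
      {|u, v|} |\<in>| edges H \<longleftrightarrow> {|g u, g v|} |\<in>| edges K"
    using assms(2) by (auto simp: graph_iso_def)
  have "f u |\<in>| verts H" if "u |\<in>| verts G" for u
    using that f by (auto simp: bij_betw_def)
  then show ?thesis
    unfolding graph_iso_def using f g ef eg
    by (intro exI[of _ "g \<circ> f"]) (auto intro: bij_betw_trans)
qed

lemma simple_map_graph:
  assumes "inj f" "simple_graph G"
  shows "simple_graph (map_graph f G)"
proof -
  obtain V E where G: "G = Graph V E" by (cases G)
  have "fcard (f |`| e) = fcard e" for e
    using assms(1) by (simp add: fcard.rep_eq card_image inj_on_subset)
  then show ?thesis
    using assms(2) by (auto simp: simple_graph_def G)
qed

section \<open>Induced pentagons as vertex lists\<close>

definition induced_on :: "'a graph \<Rightarrow> 'a fset \<Rightarrow> 'a graph" where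
  "induced_on G W = Graph W (ffilter (\<lambda>e. e |\<subseteq>| W) (edges G))"

lemma induced_on_simps [simp]:
  "verts (induced_on G W) = W"
  "edges (induced_on G W) = ffilter (\<lambda>e. e |\<subseteq>| W) (edges G)"
  by (simp_all add: induced_on_def)

text \<open>An induced subgraph is determined by its vertex set, which allows pentagons to be
  handled as sets of five vertices.\<close>

lemma induced_subgraph_iff:
  "induced_subgraph H G \<longleftrightarrow> verts H |\<subseteq>| verts G \<and> H = induced_on G (verts H)"
  by (cases H) (auto simp: induced_subgraph_def induced_on_def)

lemma simple_edge_cases:
  assumes "simple_graph G" "e |\<in>| edges G"
  obtains u v where "e = {|u, v|}" "u \<noteq> v"
proof -
  have "card (fset e) = 2" using assms by (auto simp: simple_graph_def fcard.rep_eq)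
  then obtain u v where "fset e = {u, v}" "u \<noteq> v" by (auto simp: card_2_iff)
  then have "e = {|u, v|}" by (simp add: fset_inject[symmetric])
  then show ?thesis using that \<open>u \<noteq> v\<close> by blast
qed

definition pentagon_lists :: "'a graph \<Rightarrow> 'a list set" where
  "pentagon_lists G = {c. set c \<subseteq> fset (verts G) \<and>
     induced_pentagon (\<lambda>u v. {|u, v|} |\<in>| edges G) c}"

lemma induced_pentagonE:
  assumes "induced_pentagon R xs"
  obtains a b c d e where "xs = [a, b, c, d, e]"
  using assms by (cases "(R, xs)" rule: induced_pentagon.cases) auto

lemma is_cycle_5_iff:
  "is_cycle 5 H \<longleftrightarrow> (\<exists>a b c d e. distinct [a, b, c, d, e] \<and>
     fset (verts H) = {a, b, c, d, e} \<and>
     fset (edges H) = {{|a, b|}, {|b, c|}, {|c, d|}, {|d, e|}, {|e, a|}})" (is "_ \<longleftrightarrow> ?R")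
proof -
  have len: "length xs = 5 \<longleftrightarrow> (\<exists>a b c d e. xs = [a, b, c, d, e])" for xs :: "'a list"
    by (auto simp: numeral_eq_Suc length_Suc_conv)
  have lt: "{..<5} = {0, 1, 2, 3, 4 :: nat}" by auto
  show ?thesis
  proof
    assume "is_cycle 5 H"
    then obtain xs where xs: "length xs = 5" "distinct xs" "fset (verts H) = set xs"
      "fset (edges H) = (\<lambda>i. {|xs ! i, xs ! (Suc i mod 5)|}) ` {..<5}"
      unfolding is_cycle_def by blast
    then obtain a b c d e where "xs = [a, b, c, d, e]" using len[of xs] by auto
    then show ?R
      using xs by (intro exI[of _ a] exI[of _ b] exI[of _ c] exI[of _ d] exI[of _ e]) (simp add: lt)
  next
    assume ?R
    then obtain a b c d e where abc: "distinct [a, b, c, d, e] \<and> fset (verts H) = {a, b, c, d, e} \<and>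
      fset (edges H) = {{|a, b|}, {|b, c|}, {|c, d|}, {|d, e|}, {|e, a|}}"
      by (elim exE)
    then have "fset (edges H) =
        (\<lambda>i. {|[a, b, c, d, e] ! i, [a, b, c, d, e] ! (Suc i mod 5)|}) ` {..<5}"
      by (simp add: lt)
    then show "is_cycle 5 H"
      unfolding is_cycle_def using abc by (intro conjI exI[of _ "[a, b, c, d, e]"]) simp_all
  qed
qed

text \<open>The ten pairs among five vertices are the five sides and the five chords of the cycle.
  In a simple graph the induced edges are therefore exactly the sides if and only if every side is
  an edge and no chord is.\<close>

lemma is_cycle_induced_on_iff:
  assumes "simple_graph G"
  shows "W |\<subseteq>| verts G \<and> is_cycle 5 (induced_on G W) \<longleftrightarrow> W \<in> fset_of_list ` pentagon_lists G"
proof -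
  have edges: "fset (edges (induced_on G W)) = {{|a, b|}, {|b, c|}, {|c, d|}, {|d, e|}, {|e, a|}} \<longleftrightarrow>
      induced_pentagon (\<lambda>u v. {|u, v|} |\<in>| edges G) [a, b, c, d, e]"
    if dist: "distinct [a, b, c, d, e]" and W: "fset W = {a, b, c, d, e}" for a b c d e
  proof
    let ?E = "{{|a, b|}, {|b, c|}, {|c, d|}, {|d, e|}, {|e, a|}}"
    assume E: "fset (edges (induced_on G W)) = ?E"
    have adj: "{|u, v|} |\<in>| edges G \<longleftrightarrow> {|u, v|} \<in> ?E" if "u \<in> fset W" "v \<in> fset W" for u v
      using that unfolding E[symmetric] by auto
    then show "induced_pentagon (\<lambda>u v. {|u, v|} |\<in>| edges G) [a, b, c, d, e]"
      using dist by (auto simp: adj W pair_fset_eq_iff)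
  next
    let ?E = "{{|a, b|}, {|b, c|}, {|c, d|}, {|d, e|}, {|e, a|}}"
    assume P: "induced_pentagon (\<lambda>u v. {|u, v|} |\<in>| edges G) [a, b, c, d, e]"
    have comm: "{|u, v|} = {|v, u|}" for u v :: 'a by auto
    have loop: "{|u|} |\<notin>| edges G" for u
      using assms by (auto simp: simple_graph_def fcard.rep_eq dest: spec[of _ "{|u|}"])
    show "fset (edges (induced_on G W)) = ?E"
    proof (intro equalityI subsetI)
      fix x assume "x \<in> fset (edges (induced_on G W))"
      then have x: "x |\<in>| edges G" "x |\<subseteq>| W" by auto
      then obtain u v where uv: "x = {|u, v|}" "u \<noteq> v" using simple_edge_cases[OF assms] by blast
      then have "u \<in> {a, b, c, d, e}" "v \<in> {a, b, c, d, e}" using x(2) W by auto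
      then show "x \<in> ?E"
        using P x(1) uv unfolding uv(1)
        by (elim insertE emptyE) (auto simp: comm)
    next
      fix x assume "x \<in> ?E"
      then show "x \<in> fset (edges (induced_on G W))"
        using P W by (auto simp: less_eq_fset.rep_eq)
    qed
  qed
  show ?thesis
  proof
    assume L: "W |\<subseteq>| verts G \<and> is_cycle 5 (induced_on G W)"
    then obtain a b c d e where "distinct [a, b, c, d, e]" "fset W = {a, b, c, d, e}"
      "fset (edges (induced_on G W)) = {{|a, b|}, {|b, c|}, {|c, d|}, {|d, e|}, {|e, a|}}"
      unfolding is_cycle_5_iff by auto
    then have "[a, b, c, d, e] \<in> pentagon_lists G" "W = fset_of_list [a, b, c, d, e]"
      using L edges unfolding pentagon_lists_def
      by (auto simp: less_eq_fset.rep_eq fset_inject[symmetric] simp del: induced_on_simps)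
    then show "W \<in> fset_of_list ` pentagon_lists G" by blast
  next
    assume "W \<in> fset_of_list ` pentagon_lists G"
    then obtain xs where xs: "set xs \<subseteq> fset (verts G)" "W = fset_of_list xs"
      and P: "induced_pentagon (\<lambda>u v. {|u, v|} |\<in>| edges G) xs"
      by (auto simp: pentagon_lists_def)
    obtain a b c d e where abc: "xs = [a, b, c, d, e]" using P by (rule induced_pentagonE)
    have W: "fset W = {a, b, c, d, e}" "distinct [a, b, c, d, e]" using abc xs(2) P by simp_all
    have "fset (edges (induced_on G W)) = {{|a, b|}, {|b, c|}, {|c, d|}, {|d, e|}, {|e, a|}}"
      using edges[OF W(2,1)] P abc by simp
    then have "is_cycle 5 (induced_on G W)"
      unfolding is_cycle_5_iff using W by (intro exI conjI) simp_all
    moreover have "W |\<subseteq>| verts G"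
      using W(1) xs(1) abc by (simp add: less_eq_fset.rep_eq)
    ultimately show "W |\<subseteq>| verts G \<and> is_cycle 5 (induced_on G W)" by blast
  qed
qed

lemma pentagons_simple_graph:
  assumes "simple_graph G"
  shows "pentagons G = induced_on G ` fset_of_list ` pentagon_lists G"
proof -
  have "H \<in> pentagons G \<longleftrightarrow> verts H \<in> fset_of_list ` pentagon_lists G \<and> H = induced_on G (verts H)"
    for H
    unfolding is_cycle_induced_on_iff[OF assms, symmetric] pentagons_def induced_subgraph_iff
    by auto
  then show ?thesis by (fastforce simp: image_iff)
qed

text \<open>Because pentagons are induced, their common edges are just the edges of \<open>G\<close>
  inside the common vertex set.\<close>

lemma edge_pentagon_graph_iff:
  assumes "simple_graph G" "H \<in> pentagons G" "K \<in> pentagons G"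
  shows "{|H, K|} |\<in>| edges (pentagon_graph G) \<longleftrightarrow> H \<noteq> K \<and>
    (\<exists>u v. {|u, v|} |\<in>| edges G \<and> {|u, v|} |\<subseteq>| verts H |\<inter>| verts K)"
proof -
  have "H = induced_on G (verts H)" "K = induced_on G (verts K)"
    using assms(2,3) by (auto simp: pentagons_def induced_subgraph_iff)
  then have "edges H = ffilter (\<lambda>e. e |\<subseteq>| verts H) (edges G)"
    "edges K = ffilter (\<lambda>e. e |\<subseteq>| verts K) (edges G)"
    by (metis induced_on_simps(2))+
  then have "edges H |\<inter>| edges K \<noteq> {||} \<longleftrightarrow>
      (\<exists>e. e |\<in>| edges G \<and> e |\<subseteq>| verts H |\<inter>| verts K)"
    by (auto simp: fset_eq_iff)
  also have "\<dots> \<longleftrightarrow> (\<exists>u v. {|u, v|} |\<in>| edges G \<and> {|u, v|} |\<subseteq>| verts H |\<inter>| verts K)"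
    by (metis simple_edge_cases[OF assms(1)])
  finally show ?thesis
    using assms(2,3) by (auto simp: edges_pentagon_graph pair_fset_eq_iff inf_commute)
qed

text \<open>The vertices of \<open>K\<close> label the pentagons of \<open>G\<close> through their
  vertex sets \<open>W k\<close>. This serves both for transport along an isomorphism and for
  explicit tables.\<close>

lemma pentagon_graph_isoI:
  assumes "simple_graph G" and inj: "inj_on W (fset (verts K))"
    and W: "W ` fset (verts K) = fset_of_list ` pentagon_lists G"
    and edge: "\<And>k l. k |\<in>| verts K \<Longrightarrow> l |\<in>| verts K \<Longrightarrow> {|k, l|} |\<in>| edges K \<longleftrightarrow>
      k \<noteq> l \<and> (\<exists>u v. {|u, v|} |\<in>| edges G \<and> {|u, v|} |\<subseteq>| W k |\<inter>| W l)"
  shows "pentagon_graph G \<cong>\<^sub>G K"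
proof -
  define f where "f = (\<lambda>k. induced_on G (W k))"
  have f_eq: "f k = f l \<longleftrightarrow> k = l" if "k |\<in>| verts K" "l |\<in>| verts K" for k l
    using that inj by (metis f_def induced_on_simps(1) inj_on_def)
  have image: "f ` fset (verts K) = pentagons G"
    by (simp add: f_def pentagons_simple_graph[OF assms(1)] W[symmetric] image_image)
  then have "bij_betw f (fset (verts K)) (pentagons G)"
    using f_eq by (auto simp: bij_betw_def inj_on_def)
  moreover have "{|k, l|} |\<in>| edges K \<longleftrightarrow> {|f k, f l|} |\<in>| edges (pentagon_graph G)"
    if "k |\<in>| verts K" "l |\<in>| verts K" for k l
  proof -
    have "f k \<in> pentagons G" "f l \<in> pentagons G" using that image by auto
    then show ?thesis
      using edge[OF that] f_eq[OF that] by (simp add: edge_pentagon_graph_iff[OF assms(1)] f_def)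
  qed
  ultimately have "K \<cong>\<^sub>G pentagon_graph G"
    unfolding graph_iso_def verts_pentagon_graph by blast
  then show ?thesis by (rule graph_iso_sym)
qed

lemma induced_pentagon_map:
  assumes "inj_on f A" "\<And>u v. u \<in> A \<Longrightarrow> v \<in> A \<Longrightarrow> R u v \<longleftrightarrow> R' (f u) (f v)" "set xs \<subseteq> A"
  shows "induced_pentagon R' (map f xs) \<longleftrightarrow> induced_pentagon R xs"
  using assms(3)
  by (cases "(R, xs)" rule: induced_pentagon.cases) (auto simp: assms(2) inj_on_eq_iff[OF assms(1)])

text \<open>The isomorphism \<open>f\<close> carries the pentagon lists of \<open>G\<close> onto
  those of \<open>H\<close> and, being injective on vertices, commutes with intersections of vertex
  sets. So \<open>pentagon_graph_isoI\<close> applies to \<open>H\<close>, each pentagon of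
  \<open>G\<close> being the label of its image.\<close>

lemma pentagon_graph_cong:
  assumes "G \<cong>\<^sub>G H" and simple: "simple_graph G" "simple_graph H"
  shows "pentagon_graph G \<cong>\<^sub>G pentagon_graph H"
proof -
  obtain f where bij: "bij_betw f (fset (verts G)) (fset (verts H))"
    and e: "\<And>u v. u |\<in>| verts G \<Longrightarrow> v |\<in>| verts G \<Longrightarrow>
      {|u, v|} |\<in>| edges G \<longleftrightarrow> {|f u, f v|} |\<in>| edges H"
    using assms by (auto simp: graph_iso_def)
  have inj: "inj_on f (fset (verts G))" and img: "f ` fset (verts G) = fset (verts H)"
    using bij by (auto simp: bij_betw_def)
  have pent_iff: "map f xs \<in> pentagon_lists H \<longleftrightarrow> xs \<in> pentagon_lists G"
    if "set xs \<subseteq> fset (verts G)" for xs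
    using that induced_pentagon_map[where R = "\<lambda>u v. {|u, v|} |\<in>| edges G" and
      R' = "\<lambda>u v. {|u, v|} |\<in>| edges H", OF inj _ that] e img[symmetric] by (auto simp: pentagon_lists_def)
  have lists: "pentagon_lists H = map f ` pentagon_lists G"
  proof (intro equalityI subsetI)
    fix ys assume ys: "ys \<in> pentagon_lists H"
    then have "ys \<in> lists (f ` fset (verts G))" by (auto simp: pentagon_lists_def img)
    then obtain xs where "ys = map f xs" "set xs \<subseteq> fset (verts G)"
      by (auto simp: lists_image)
    then show "ys \<in> map f ` pentagon_lists G" using ys pent_iff by blast
  next
    fix ys assume "ys \<in> map f ` pentagon_lists G"
    then obtain xs where "ys = map f xs" "xs \<in> pentagon_lists G" by blast
    moreover from this have "set xs \<subseteq> fset (verts G)" by (simp add: pentagon_lists_def)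
    ultimately show "ys \<in> pentagon_lists H" using pent_iff by blast
  qed
  have sub: "verts P |\<subseteq>| verts G" if "P \<in> pentagons G" for P
    using that by (simp add: pentagons_def induced_subgraph_def)
  have verts_inj: "P = Q" if "P \<in> pentagons G" "Q \<in> pentagons G" "verts P = verts Q" for P Q
    using that by (metis (no_types, lifting) induced_subgraph_iff mem_Collect_eq pentagons_def)
  have "pentagon_graph H \<cong>\<^sub>G pentagon_graph G"
  proof (rule pentagon_graph_isoI[OF simple(2), where W = "\<lambda>P. f |`| verts P"])
    show "inj_on (\<lambda>P. f |`| verts P) (fset (verts (pentagon_graph G)))"
    proof (rule inj_onI)
      fix P Q assume PQ: "P \<in> fset (verts (pentagon_graph G))" "Q \<in> fset (verts (pentagon_graph G))"
        and "f |`| verts P = f |`| verts Q"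
      then have "f ` fset (verts P) = f ` fset (verts Q)" by (metis fimage.rep_eq)
      then have "verts P = verts Q"
        using PQ sub inj by (simp add: verts_pentagon_graph less_eq_fset.rep_eq inj_on_image_eq_iff fset_inject)
      then show "P = Q" using PQ verts_inj by (simp add: verts_pentagon_graph)
    qed
    have "fset_of_list (map f xs) = f |`| fset_of_list xs" for xs
      by (simp add: fset_inject[symmetric] fset_of_list.rep_eq)
    then show "(\<lambda>P. f |`| verts P) ` fset (verts (pentagon_graph G)) = fset_of_list ` pentagon_lists H"
      by (simp add: verts_pentagon_graph pentagons_simple_graph[OF simple(1)] lists image_image)
    fix P Q assume "P |\<in>| verts (pentagon_graph G)" "Q |\<in>| verts (pentagon_graph G)"
    then have PQ: "P \<in> pentagons G" "Q \<in> pentagons G" by (simp_all add: verts_pentagon_graph)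
    have "(\<exists>u v. {|u, v|} |\<in>| edges G \<and> {|u, v|} |\<subseteq>| verts P |\<inter>| verts Q) \<longleftrightarrow>
        (\<exists>u v. {|u, v|} |\<in>| edges H \<and> {|u, v|} |\<subseteq>| f |`| verts P |\<inter>| f |`| verts Q)" (is "?L \<longleftrightarrow> ?R")
    proof -
      have "f |`| verts P |\<inter>| f |`| verts Q = f |`| (verts P |\<inter>| verts Q)"
        using inj_on_image_Int[OF inj, of "fset (verts P)" "fset (verts Q)"] sub PQ
        by (simp add: fset_inject[symmetric] less_eq_fset.rep_eq)
      then have R: "?R \<longleftrightarrow> (\<exists>u v. {|u, v|} |\<in>| edges H \<and> {|u, v|} |\<subseteq>| f |`| (verts P |\<inter>| verts Q))"
        by simp
      have G: "u |\<in>| verts G" if "u |\<in>| verts P |\<inter>| verts Q" for u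
        using that sub[OF PQ(1)] by auto
      show ?thesis
      proof
        assume ?L
        then obtain u v where uv: "{|u, v|} |\<in>| edges G" "u |\<in>| verts P |\<inter>| verts Q"
          "v |\<in>| verts P |\<inter>| verts Q" by auto
        then have "{|f u, f v|} |\<in>| edges H" using e G by blast
        moreover have "{|f u, f v|} |\<subseteq>| f |`| (verts P |\<inter>| verts Q)" using uv(2,3) by auto
        ultimately show ?R unfolding R by blast
      next
        assume ?R
        then obtain u v where uv: "{|f u, f v|} |\<in>| edges H" "u |\<in>| verts P |\<inter>| verts Q"
          "v |\<in>| verts P |\<inter>| verts Q" unfolding R by auto
        then have "{|u, v|} |\<in>| edges G" using e G by blast
        then show ?L using uv(2,3) by (intro exI[of _ u] exI[of _ v]) auto
      qed
    qed
    then show "{|P, Q|} |\<in>| edges (pentagon_graph G) \<longleftrightarrow> P \<noteq> Q \<and>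
        (\<exists>u v. {|u, v|} |\<in>| edges H \<and> {|u, v|} |\<subseteq>| f |`| verts P |\<inter>| f |`| verts Q)"
      by (simp add: edge_pentagon_graph_iff[OF simple(1) PQ])
  qed
  then show ?thesis by (rule graph_iso_sym)
qed

text \<open>
  \<open>F\<close> labels the induced pentagons of \<open>N\<close> by the vertices of \<open>M\<close>. The second conjunct is
  exhaustiveness, with the search pruned as soon as the path \<open>a, b, c, d, e\<close> has a chord.
\<close>

definition pentagon_table ::
  "(int \<times> int list) list \<Rightarrow> (int \<times> int list) list \<Rightarrow> (int \<times> int list) list \<Rightarrow> bool" where
  "pentagon_table N M F \<longleftrightarrow>
     (\<forall>k\<in>set (map fst M). set (entry F k) \<subseteq> set (map fst N) \<and>
        induced_pentagon (\<lambda>i j. j \<in> set (entry N i)) (entry F k)) \<and>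
     (\<forall>a\<in>set (map fst N). \<forall>b\<in>set (entry N a). \<forall>c\<in>set (entry N b).
        c = a \<or> c \<in> set (entry N a) \<or>
        (\<forall>d\<in>set (entry N c). d \<in> set (entry N a) \<or> d \<in> set (entry N b) \<or>
          (\<forall>e\<in>set (entry N d). e \<notin> set (entry N a) \<or> e \<in> set (entry N b) \<or> e \<in> set (entry N c) \<or>
            (\<exists>k\<in>set (map fst M). set [a, b, c, d, e] = set (entry F k))))) \<and>
     (\<forall>k\<in>set (map fst M). \<forall>l\<in>set (map fst M). k \<noteq> l \<longrightarrow> set (entry F k) \<noteq> set (entry F l)) \<and>
     (\<forall>k\<in>set (map fst M). \<forall>l\<in>set (map fst M). l \<in> set (entry M k) \<longleftrightarrow> k \<noteq> l \<and>
        (\<exists>i\<in>set (entry F k). i \<in> set (entry F l) \<and>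
           (\<exists>j\<in>set (entry F k). j \<in> set (entry F l) \<and> j \<in> set (entry N i))))"

text \<open>Soundness and exhaustiveness of \<open>F\<close> give the image condition of
  \<open>pentagon_graph_isoI\<close>; the last two conjuncts of the table give injectivity and the
  edge condition.\<close>

lemma pentagon_graph_adjacency_graph:
  assumes wf: "nbrs_wf N" "nbrs_wf M" and table: "pentagon_table N M F"
  shows "pentagon_graph (adjacency_graph N) \<cong>\<^sub>G adjacency_graph M"
proof -
  define R where "R i j \<longleftrightarrow> {|i, j|} |\<in>| edges (adjacency_graph N)" for i j
  have R: "R i j \<longleftrightarrow> i \<in> set (map fst N) \<and> j \<in> set (entry N i)" for i j
    unfolding R_def by (rule edge_adjacency_graph_iff[OF wf(1)])
  have sym: "R i j \<longleftrightarrow> R j i" for i j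
    by (simp add: R_def finsert_commute)
  note pentagon = table[unfolded pentagon_table_def, THEN conjunct1, rule_format]
    and complete = table[unfolded pentagon_table_def, THEN conjunct2, THEN conjunct1, rule_format]
    and distinct = table[unfolded pentagon_table_def, THEN conjunct2, THEN conjunct2, THEN conjunct1, rule_format]
    and sharing = table[unfolded pentagon_table_def, THEN conjunct2, THEN conjunct2, THEN conjunct2, rule_format]
  have eq_iff: "fset_of_list xs = fset_of_list ys \<longleftrightarrow> set xs = set ys" for xs ys :: "int list"
    by (simp add: fset_inject[symmetric] fset_of_list.rep_eq)
  have list: "entry F k \<in> pentagon_lists (adjacency_graph N)" if "k \<in> set (map fst M)" for k
  proof -
    have sub: "set (entry F k) \<subseteq> set (map fst N)"
      and "induced_pentagon (\<lambda>i j. j \<in> set (entry N i)) (entry F k)"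
      using pentagon[OF that] by blast+
    then have "induced_pentagon R (entry F k)"
      using induced_pentagon_map[of id "set (map fst N)" "\<lambda>i j. j \<in> set (entry N i)" R] R by simp
    then show ?thesis
      using sub unfolding pentagon_lists_def verts_adjacency_graph R_def by blast
  qed
  \<comment> \<open>Read as a path \<open>a, b, c, d, e\<close>, an induced pentagon survives every
    pruning test, so only the last alternative of the search remains.\<close>
  have covered: "\<exists>k\<in>set (map fst M). set xs = set (entry F k)"
    if xs: "xs \<in> pentagon_lists (adjacency_graph N)" for xs
  proof -
    have P: "induced_pentagon R xs"
      using xs unfolding pentagon_lists_def R_def by blast
    then obtain a b c d e where abc: "xs = [a, b, c, d, e]" by (rule induced_pentagonE)
    \<comment> \<open>The closing edge is turned round to \<open>R a e\<close>, the form in which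
      the search tests it.\<close>
    have dist: "distinct [a, b, c, d, e]"
      and edge: "R a b" "R b c" "R c d" "R d e" "R a e"
      and nonedge: "\<not> R a c" "\<not> R a d" "\<not> R b d" "\<not> R b e" "\<not> R c e"
      using P abc sym by auto
    from edge nonedge have mem: "a \<in> set (map fst N)" "b \<in> set (entry N a)" "c \<in> set (entry N b)"
      "d \<in> set (entry N c)" "e \<in> set (entry N d)" "e \<in> set (entry N a)"
      "c \<notin> set (entry N a)" "d \<notin> set (entry N a)" "d \<notin> set (entry N b)"
      "e \<notin> set (entry N b)" "e \<notin> set (entry N c)"
      unfolding R by blast+
    have "c \<noteq> a" using dist by auto
    with mem(7) have "\<forall>d\<in>set (entry N c). d \<in> set (entry N a) \<or> d \<in> set (entry N b) \<or>
        (\<forall>e\<in>set (entry N d). e \<notin> set (entry N a) \<or> e \<in> set (entry N b) \<or> e \<in> set (entry N c) \<or>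
          (\<exists>k\<in>set (map fst M). set [a, b, c, d, e] = set (entry F k)))"
      using complete[OF mem(1-3)] by simp
    from bspec[OF this mem(4)] mem(8,9)
    have "\<forall>e\<in>set (entry N d). e \<notin> set (entry N a) \<or> e \<in> set (entry N b) \<or>
        e \<in> set (entry N c) \<or> (\<exists>k\<in>set (map fst M). set [a, b, c, d, e] = set (entry F k))"
      by simp
    from bspec[OF this mem(5)] mem(6,10,11) show ?thesis unfolding abc by simp
  qed
  show ?thesis
  proof (rule pentagon_graph_isoI[OF simple_adjacency_graph[OF wf(1)], where W = "\<lambda>k. fset_of_list (entry F k)"],
      unfold verts_adjacency_graph)
    show "inj_on (\<lambda>k. fset_of_list (entry F k)) (set (map fst M))"
      unfolding inj_on_def eq_iff using distinct by metis
    show "(\<lambda>k. fset_of_list (entry F k)) ` set (map fst M) =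
        fset_of_list ` pentagon_lists (adjacency_graph N)"
    proof (intro equalityI subsetI)
      fix x assume "x \<in> fset_of_list ` pentagon_lists (adjacency_graph N)"
      then obtain xs where "xs \<in> pentagon_lists (adjacency_graph N)" "x = fset_of_list xs" by blast
      then show "x \<in> (\<lambda>k. fset_of_list (entry F k)) ` set (map fst M)"
        using covered[of xs] eq_iff by blast
    qed (use list in blast)
    fix k l assume kl: "k \<in> set (map fst M)" "l \<in> set (map fst M)"
    have "set (entry F k) \<subseteq> set (map fst N)" using pentagon[OF kl(1)] by blast
    then have "(\<exists>i\<in>set (entry F k). i \<in> set (entry F l) \<and>
           (\<exists>j\<in>set (entry F k). j \<in> set (entry F l) \<and> j \<in> set (entry N i))) \<longleftrightarrow>
        (\<exists>i j. R i j \<and> {|i, j|} |\<subseteq>| fset_of_list (entry F k) |\<inter>| fset_of_list (entry F l))"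
      unfolding R by (auto simp: fset_of_list_elem) blast+
    moreover have "{|k, l|} |\<in>| edges (adjacency_graph M) \<longleftrightarrow> l \<in> set (entry M k)"
      using edge_adjacency_graph_iff[OF wf(2)] kl by blast
    moreover have "l \<in> set (entry M k) \<longleftrightarrow> k \<noteq> l \<and>
        (\<exists>i\<in>set (entry F k). i \<in> set (entry F l) \<and>
           (\<exists>j\<in>set (entry F k). j \<in> set (entry F l) \<and> j \<in> set (entry N i)))"
      by (rule sharing[OF kl])
    ultimately show "{|k, l|} |\<in>| edges (adjacency_graph M) \<longleftrightarrow> k \<noteq> l \<and>
        (\<exists>u v. {|u, v|} |\<in>| edges (adjacency_graph N) \<and>
          {|u, v|} |\<subseteq>| fset_of_list (entry F k) |\<inter>| fset_of_list (entry F l))"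
      unfolding R_def by simp
  qed
qed

section \<open>The dodecahedron and the icosahedron\<close>

text \<open>The sign pairs run through (-1, -1), (-1, 1), (1, -1), (1, 1), with three cyclic
  permutations each.\<close>

definition icosahedron_coords :: "(int \<times> coords) list" where
  "icosahedron_coords =
  [(0, ((0, 0), (-1, 0), (0, -1))),
   (1, ((-1, 0), (0, -1), (0, 0))),
   (2, ((0, -1), (0, 0), (-1, 0))),
   (3, ((0, 0), (-1, 0), (0, 1))),
   (4, ((-1, 0), (0, 1), (0, 0))),
   (5, ((0, 1), (0, 0), (-1, 0))),
   (6, ((0, 0), (1, 0), (0, -1))),
   (7, ((1, 0), (0, -1), (0, 0))),
   (8, ((0, -1), (0, 0), (1, 0))),
   (9, ((0, 0), (1, 0), (0, 1))),
   (10, ((1, 0), (0, 1), (0, 0))),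
   (11, ((0, 1), (0, 0), (1, 0)))]"

text \<open>The eight vertices of a cube come first. In the others \<open>(-1, 1)\<close> stands for
  \<open>1 / \<phi>\<close> and \<open>(1, -1)\<close> for its negative.\<close>

definition dodecahedron_coords :: "(int \<times> coords) list" where
  "dodecahedron_coords =
  [(0, ((-1, 0), (-1, 0), (-1, 0))),
   (1, ((-1, 0), (-1, 0), (1, 0))),
   (2, ((-1, 0), (1, 0), (-1, 0))),
   (3, ((-1, 0), (1, 0), (1, 0))),
   (4, ((1, 0), (-1, 0), (-1, 0))),
   (5, ((1, 0), (-1, 0), (1, 0))),
   (6, ((1, 0), (1, 0), (-1, 0))),
   (7, ((1, 0), (1, 0), (1, 0))),
   (8, ((0, 0), (1, -1), (0, -1))),
   (9, ((1, -1), (0, -1), (0, 0))),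
   (10, ((0, -1), (0, 0), (1, -1))),
   (11, ((0, 0), (1, -1), (0, 1))),
   (12, ((1, -1), (0, 1), (0, 0))),
   (13, ((0, 1), (0, 0), (1, -1))),
   (14, ((0, 0), (-1, 1), (0, -1))),
   (15, ((-1, 1), (0, -1), (0, 0))),
   (16, ((0, -1), (0, 0), (-1, 1))),
   (17, ((0, 0), (-1, 1), (0, 1))),
   (18, ((-1, 1), (0, 1), (0, 0))),
   (19, ((0, 1), (0, 0), (-1, 1)))]"

definition icosahedron_nbrs :: "(int \<times> int list) list" where
  "icosahedron_nbrs =
  [(0, [1, 2, 5, 6, 7]),
   (1, [0, 2, 3, 7, 8]),
   (2, [0, 1, 4, 6, 8]),
   (3, [1, 7, 8, 9, 11]),
   (4, [2, 6, 8, 9, 10]),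
   (5, [0, 6, 7, 10, 11]),
   (6, [0, 2, 4, 5, 10]),
   (7, [0, 1, 3, 5, 11]),
   (8, [1, 2, 3, 4, 9]),
   (9, [3, 4, 8, 10, 11]),
   (10, [4, 5, 6, 9, 11]),
   (11, [3, 5, 7, 9, 10])]"

definition dodecahedron_nbrs :: "(int \<times> int list) list" where
  "dodecahedron_nbrs =
  [(0, [8, 9, 10]),
   (1, [9, 11, 16]),
   (2, [10, 12, 14]),
   (3, [12, 16, 17]),
   (4, [8, 13, 15]),
   (5, [11, 15, 19]),
   (6, [13, 14, 18]),
   (7, [17, 18, 19]),
   (8, [0, 4, 14]),
   (9, [0, 1, 15]),
   (10, [0, 2, 16]),
   (11, [1, 5, 17]),
   (12, [2, 3, 18]),
   (13, [4, 6, 19]),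
   (14, [2, 6, 8]),
   (15, [4, 5, 9]),
   (16, [1, 3, 10]),
   (17, [3, 7, 11]),
   (18, [6, 7, 12]),
   (19, [5, 7, 13])]"

text \<open>The label of a link is in general not its centre: entries 0, 1, 2 are the links of 7, 2,
  9. The map from labels to centres takes adjacency to distance 2.\<close>

definition icosahedron_pentagons :: "(int \<times> int list) list" where
  "icosahedron_pentagons =
  [(0, [0, 1, 3, 11, 5]),
   (1, [0, 1, 8, 4, 6]),
   (2, [3, 8, 4, 10, 11]),
   (3, [1, 7, 11, 9, 8]),
   (4, [0, 2, 8, 3, 7]),
   (5, [1, 2, 4, 9, 3]),
   (6, [0, 2, 4, 10, 5]),
   (7, [4, 6, 5, 11, 9]),
   (8, [0, 6, 10, 11, 7]),
   (9, [2, 6, 10, 9, 8]),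
   (10, [3, 7, 5, 10, 9]),
   (11, [1, 2, 6, 5, 7])]"

text \<open>Polyhedral duality fixes the labels: face \<open>k\<close> is centred in the direction
  of icosahedron vertex \<open>k\<close> with its second and third coordinates exchanged.\<close>

definition dodecahedron_pentagons :: "(int \<times> int list) list" where
  "dodecahedron_pentagons =
  [(0, [0, 8, 4, 15, 9]),
   (1, [0, 8, 14, 2, 10]),
   (2, [0, 9, 1, 16, 10]),
   (3, [2, 12, 18, 6, 14]),
   (4, [1, 11, 17, 3, 16]),
   (5, [4, 13, 19, 5, 15]),
   (6, [1, 9, 15, 5, 11]),
   (7, [4, 8, 14, 6, 13]),
   (8, [2, 10, 16, 3, 12]),
   (9, [3, 12, 18, 7, 17]),
   (10, [5, 11, 17, 7, 19]),
   (11, [6, 13, 19, 7, 18])]"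

section \<open>Verification of the tables by evaluation\<close>

lemma icosahedron_nbrs_wf: "nbrs_wf icosahedron_nbrs"
  by code_simp

lemma dodecahedron_nbrs_wf: "nbrs_wf dodecahedron_nbrs"
  by code_simp

text \<open>The squared radius is \<open>1 + \<phi>\<^sup>2 = 2 + \<phi>\<close>; adjacent vertices
  have inner product \<open>\<phi>\<^sup>2 - 1 = \<phi>\<close>.\<close>

lemma icosahedron_skeleton_table: "skeleton_table icosahedron_nbrs icosahedron_coords (2, 1) (0, 1)"
  by code_simp

text \<open>The squared radius is 3; adjacent vertices have inner product
  \<open>1 / \<phi> + \<phi> = 2\<phi> - 1\<close>, which is \<open>sqrt 5\<close>.\<close>

lemma dodecahedron_skeleton_table: "skeleton_table dodecahedron_nbrs dodecahedron_coords (3, 0) (-1, 2)"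
  by code_simp

lemma icosahedron_pentagon_table: "pentagon_table icosahedron_nbrs icosahedron_nbrs icosahedron_pentagons"
  by code_simp

lemma dodecahedron_pentagon_table: "pentagon_table dodecahedron_nbrs icosahedron_nbrs dodecahedron_pentagons"
  by code_simp

lemma icosahedron_graph_iso: "adjacency_graph icosahedron_nbrs \<cong>\<^sub>G icosahedron_graph"
proof -
  have "icosahedron = convex hull (coords_vec ` set (map snd icosahedron_coords))"
    by (simp add: icosahedron_def sgns_def icosahedron_coords_def coords_vec_def zphi_real_def insert_commute)
  moreover have "adjacency_graph icosahedron_nbrs \<cong>\<^sub>G
      skeleton_graph (convex hull (coords_vec ` set (map snd icosahedron_coords)))"
    by (rule adjacency_graph_iso_skeleton[OF icosahedron_nbrs_wf _ _ icosahedron_skeleton_table])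
      (simp_all add: icosahedron_coords_def icosahedron_nbrs_def zphi_real_def)
  ultimately show ?thesis by (simp add: icosahedron_graph_def)
qed

lemma dodecahedron_graph_iso: "adjacency_graph dodecahedron_nbrs \<cong>\<^sub>G dodecahedron_graph"
proof -
  have inv: "s / \<phi> = s * (\<phi> - 1)" for s :: real
    by (simp only: inverse_golden[symmetric] times_divide_eq_right mult_1_right)
  have "dodecahedron = convex hull (coords_vec ` set (map snd dodecahedron_coords))"
    by (simp add: dodecahedron_def sgns_def dodecahedron_coords_def coords_vec_def zphi_real_def inv insert_commute)
  moreover have "adjacency_graph dodecahedron_nbrs \<cong>\<^sub>G
      skeleton_graph (convex hull (coords_vec ` set (map snd dodecahedron_coords)))"
    \<comment> \<open>The strict comparison here is \<open>2\<phi> - 1 < 3\<close>, that is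
      \<open>\<phi> < 2\<close>.\<close>
    by (rule adjacency_graph_iso_skeleton[OF dodecahedron_nbrs_wf _ _ dodecahedron_skeleton_table])
      (use golden_less_2 in \<open>simp_all add: dodecahedron_coords_def dodecahedron_nbrs_def zphi_real_def\<close>)
  ultimately show ?thesis by (simp add: dodecahedron_graph_def)
qed

section \<open>Pentagon graphs and iterates of the two solids\<close>

lemma simple_icosahedron_graph: "simple_graph icosahedron_graph"
  and simple_dodecahedron_graph: "simple_graph dodecahedron_graph"
  by (simp_all add: icosahedron_graph_def dodecahedron_graph_def simple_skeleton_graph
      polytope_icosahedron polytope_dodecahedron)

lemma pentagon_graph_icosahedron: "pentagon_graph icosahedron_graph \<cong>\<^sub>G icosahedron_graph"
proof -
  have "pentagon_graph icosahedron_graph \<cong>\<^sub>G pentagon_graph (adjacency_graph icosahedron_nbrs)"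
    by (intro pentagon_graph_cong graph_iso_sym[OF icosahedron_graph_iso] simple_icosahedron_graph
        simple_adjacency_graph icosahedron_nbrs_wf)
  also have "\<dots> \<cong>\<^sub>G adjacency_graph icosahedron_nbrs"
    by (rule pentagon_graph_adjacency_graph[OF icosahedron_nbrs_wf icosahedron_nbrs_wf
          icosahedron_pentagon_table])
  also note icosahedron_graph_iso
  finally show ?thesis .
qed

lemma pentagon_graph_dodecahedron: "pentagon_graph dodecahedron_graph \<cong>\<^sub>G icosahedron_graph"
proof -
  have "pentagon_graph dodecahedron_graph \<cong>\<^sub>G pentagon_graph (adjacency_graph dodecahedron_nbrs)"
    by (intro pentagon_graph_cong graph_iso_sym[OF dodecahedron_graph_iso] simple_dodecahedron_graph
        simple_adjacency_graph dodecahedron_nbrs_wf)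
  also have "\<dots> \<cong>\<^sub>G adjacency_graph icosahedron_nbrs"
    by (rule pentagon_graph_adjacency_graph[OF dodecahedron_nbrs_wf icosahedron_nbrs_wf
          dodecahedron_pentagon_table])
  also note icosahedron_graph_iso
  finally show ?thesis .
qed

text \<open>Needed for \<open>pentagon_graph_cong\<close>. Iterate 0 inherits simplicity from
  \<open>G\<close>; every later one is a relabelled pentagon graph.\<close>

lemma simple_pentagon_iterate:
  assumes "simple_graph G"
  shows "simple_graph (pentagon_iterate n G)"
  using assms
  by (cases n)
    (auto simp: pentagon_iterate_def inj_def intro!: simple_map_graph simple_pentagon_graph)

text \<open>Iterate 0 is still the dodecahedron graph, so the claim starts at iterate 1; from there
  on the icosahedron graph reproduces itself.\<close>

lemma pentagon_iterate_dodecahedron: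
  "pentagon_iterate (Suc n) dodecahedron_graph \<cong>\<^sub>G icosahedron_graph"
proof (induction n)
  case 0
  note pentagon_iterate_Suc
  also have "pentagon_graph (pentagon_iterate 0 dodecahedron_graph) \<cong>\<^sub>G
      pentagon_graph dodecahedron_graph"
    by (intro pentagon_graph_cong pentagon_iterate_0 simple_pentagon_iterate
        simple_dodecahedron_graph)
  also note pentagon_graph_dodecahedron
  finally show ?case .
next
  case (Suc n)
  note pentagon_iterate_Suc
  also have "pentagon_graph (pentagon_iterate (Suc n) dodecahedron_graph) \<cong>\<^sub>G
      pentagon_graph icosahedron_graph"
    by (intro pentagon_graph_cong Suc.IH simple_pentagon_iterate simple_dodecahedron_graph
        simple_icosahedron_graph)
  also note pentagon_graph_icosahedron
  finally show ?case .
qed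

theorem proposition3p2:
  shows "pentagon_graph dodecahedron_graph \<cong>\<^sub>G icosahedron_graph \<and>
         pentagon_graph icosahedron_graph \<cong>\<^sub>G icosahedron_graph \<and>
         (\<exists>(m::nat) (p::nat). p > 0 \<and>
            (\<forall>n\<ge>m. pentagon_iterate (n + p) dodecahedron_graph \<cong>\<^sub>G
                    pentagon_iterate n dodecahedron_graph))"
proof -
  have "pentagon_iterate (n + 1) dodecahedron_graph \<cong>\<^sub>G pentagon_iterate n dodecahedron_graph"
    if n: "n \<ge> 1" for n
  proof -
    obtain k where "n = Suc k" using n by (cases n) auto
    then show ?thesis
      using graph_iso_trans[OF pentagon_iterate_dodecahedron
          graph_iso_sym[OF pentagon_iterate_dodecahedron], of n k] by simp
  qed
  then show ?thesis
    using pentagon_graph_dodecahedron pentagon_graph_icosahedron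
    \<comment> \<open>The witness 1 serves for both \<open>m\<close> and \<open>p\<close>.\<close>
    by (intro conjI exI[of _ 1]) auto
qed

end
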